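(* Let $\Gamma$ be a finite simple graph with vertex set $V=\{1,\dots,n\}$. There is a short exact sequence $$1\longrightarrow P_\Gamma\longrightarrow B_\Gamma\longrightarrow \operatorname{Aut}(\Gamma)\longrightarrow 1.$$
   Context: $B_n$ is the Artin braid group on $n$ strands with standard generators $\sigma_1,\dots,\sigma_{n-1}$; $p\colon B_n\to S_n$ is the homomorphism with $p(\sigma_i)=(i,i+1)$; $P_n=\ker p$ is the pure braid group, generated by $a_{ij}=\sigma_{j-1}\cdots\sigma_{i+1}\sigma_i^2\sigma_{i+1}^{-1}\cdots\sigma_{j-1}^{-1}$, $1\le i<j\le n$. For $\Gamma$ with edge set $E_\Gamma\subseteq\binom{V}{2}$, let $N$ be the normal closure in $P_n$ of $\{a_{ij}\mid i<j,\ \{i,j\}\notin E_\Gamma\}$; the graphic pure braid group is $P_\Gamma=P_n/N$. $\operatorname{Aut}(\Gamma)\subseteq S_n$ is the group of permutations $s$ with $\{s(i),s(j)\}\in E_\Gamma$ for all $\{i,j\}\in E_\Gamma$, and $\tilde B_\Gamma=p^{-1}(\operatorname{Aut}(\Gamma))\subseteq B_n$. The subgroup $N$ is normal in $\tilde B_\Gamma$, and the graphic braid group is $B_\Gamma=\tilde B_\Gamma/N$. *)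

theory Defs
  imports "HOL-Algebra.Sym_Groups" "HOL-Algebra.Exact_Sequence"
begin

section \<open>Artin braid groups\<close>

text \<open>
  Words in the letters \<open>\<sigma>\<^sub>i\<close>, written \<open>(i, True)\<close>, and \<open>\<sigma>\<^sub>i\<close> inverse, written \<open>(i, False)\<close>.
  \<open>B\<^sub>n\<close> is given by the Artin presentation, as the words over \<open>\<sigma>\<^sub>1, \<dots>, \<sigma>\<^sub>n\<^sub>-\<^sub>1\<close> modulo the congruence
  generated by free cancellation and the braid relations.
\<close>

type_synonym braid_word = "(nat \<times> bool) list"

definition braid_words :: "nat \<Rightarrow> braid_word set"
  where "braid_words n = lists ({i. 1 \<le> i \<and> i < n} \<times> UNIV)"

inductive_set braid_rel :: "nat \<Rightarrow> (braid_word \<times> braid_word) set" for n :: nat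
  where
    refl: "w \<in> braid_words n \<Longrightarrow> (w, w) \<in> braid_rel n"
  | sym: "(v, w) \<in> braid_rel n \<Longrightarrow> (w, v) \<in> braid_rel n"
  | trans: "(u, v) \<in> braid_rel n \<Longrightarrow> (v, w) \<in> braid_rel n \<Longrightarrow> (u, w) \<in> braid_rel n"
  | append: "(v, w) \<in> braid_rel n \<Longrightarrow> (v', w') \<in> braid_rel n \<Longrightarrow> (v @ v', w @ w') \<in> braid_rel n"
  | cancel: "1 \<le> i \<Longrightarrow> i < n \<Longrightarrow> ([(i, e), (i, \<not> e)], []) \<in> braid_rel n"
  | commute: "1 \<le> i \<Longrightarrow> i + 2 \<le> j \<Longrightarrow> j < n \<Longrightarrow>
      ([(i, True), (j, True)], [(j, True), (i, True)]) \<in> braid_rel n"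
  | braid: "1 \<le> i \<Longrightarrow> i + 1 < n \<Longrightarrow>
      ([(i, True), (i + 1, True), (i, True)], [(i + 1, True), (i, True), (i + 1, True)]) \<in> braid_rel n"

definition braid_class :: "nat \<Rightarrow> braid_word \<Rightarrow> braid_word set"
  where "braid_class n w = braid_rel n `` {w}"

definition braid_group :: "nat \<Rightarrow> braid_word set monoid"
  where "braid_group n =
    \<lparr>carrier = braid_words n // braid_rel n,
     mult = (\<lambda>C D. \<Union>x\<in>C. \<Union>y\<in>D. braid_class n (x @ y)),
     one = braid_class n []\<rparr>"

definition braid_sigma :: "nat \<Rightarrow> nat \<Rightarrow> braid_word set"
  where "braid_sigma n i = braid_class n [(i, True)]"

text \<open>
  The exponents play no role in \<^term>\<open>word_perm\<close>, transpositions being involutions. Products in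
  \<^const>\<open>sym_group\<close> are compositions \<open>(\<circ>)\<close>. That \<open>word_perm\<close> is constant on classes, so that
  \<open>braid_perm\<close> is the homomorphism \<open>p : B\<^sub>n \<rightarrow> S\<^sub>n\<close> with \<open>p(\<sigma>\<^sub>i) = (i, i+1)\<close>, is proved below.
\<close>

fun word_perm :: "braid_word \<Rightarrow> nat \<Rightarrow> nat"
  where
    "word_perm [] = id"
  | "word_perm ((i, e) # w) = transpose i (i + 1) \<circ> word_perm w"

definition braid_perm :: "braid_word set \<Rightarrow> nat \<Rightarrow> nat"
  where "braid_perm C = the_elem (word_perm ` C)"

definition pure_braid_group :: "nat \<Rightarrow> braid_word set monoid"
  where "pure_braid_group n =
    (braid_group n)\<lparr>carrier := kernel (braid_group n) (sym_group n) braid_perm\<rparr>"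

text \<open>\<open>a\<^sub>i\<^sub>j = \<sigma>\<^sub>j\<^sub>-\<^sub>1 \<cdots> \<sigma>\<^sub>i\<^sub>+\<^sub>1 \<sigma>\<^sub>i\<^sup>2 \<sigma>\<^sub>i\<^sub>+\<^sub>1\<^sup>-\<^sup>1 \<cdots> \<sigma>\<^sub>j\<^sub>-\<^sub>1\<^sup>-\<^sup>1\<close>\<close>

definition pure_braid_gen :: "nat \<Rightarrow> nat \<Rightarrow> nat \<Rightarrow> braid_word set"
  where "pure_braid_gen n i j = braid_class n
    (map (\<lambda>k. (k, True)) (rev [i + 1..<j]) @ [(i, True), (i, True)] @
     map (\<lambda>k. (k, False)) [i + 1..<j])"


section \<open>Graphic braid groups\<close>

definition simple_graph :: "nat \<Rightarrow> nat set set \<Rightarrow> bool"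
  where "simple_graph n E \<longleftrightarrow> (\<forall>e\<in>E. e \<subseteq> {1..n} \<and> card e = 2)"

definition graph_aut_group :: "nat \<Rightarrow> nat set set \<Rightarrow> (nat \<Rightarrow> nat) monoid"
  where "graph_aut_group n E = (sym_group n)
    \<lparr>carrier := {s \<in> carrier (sym_group n). \<forall>i j. {i, j} \<in> E \<longrightarrow> {s i, s j} \<in> E}\<rparr>"

definition normal_closure :: "('a, 'b) monoid_scheme \<Rightarrow> 'a set \<Rightarrow> 'a set"
  where "normal_closure G S = \<Inter>{K. K \<lhd> G \<and> S \<subseteq> K}"

definition graphic_kernel :: "nat \<Rightarrow> nat set set \<Rightarrow> braid_word set set"
  where "graphic_kernel n E = normal_closure (pure_braid_group n)
    {pure_braid_gen n i j | i j. 1 \<le> i \<and> i < j \<and> j \<le> n \<and> {i, j} \<notin> E}"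

definition graphic_pure_braid_group :: "nat \<Rightarrow> nat set set \<Rightarrow> braid_word set set monoid"
  where "graphic_pure_braid_group n E = pure_braid_group n Mod graphic_kernel n E"

definition aut_braid_group :: "nat \<Rightarrow> nat set set \<Rightarrow> braid_word set monoid"
  where "aut_braid_group n E = (braid_group n)
    \<lparr>carrier := {b \<in> carrier (braid_group n). braid_perm b \<in> carrier (graph_aut_group n E)}\<rparr>"

definition graphic_braid_group :: "nat \<Rightarrow> nat set set \<Rightarrow> braid_word set set monoid"
  where "graphic_braid_group n E = aut_braid_group n E Mod graphic_kernel n E"


section \<open>Short exact sequences\<close>

text \<open>
  The library's \<^const>\<open>short_exact_sequence\<close> requires the three groups to have the same element
  type; this is the same notion without that restriction, for \<open>1 \<rightarrow> A \<rightarrow> B \<rightarrow> C \<rightarrow> 1\<close> with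
  maps \<open>f\<close> and \<open>g\<close>.
\<close>

definition short_exact ::
    "('a, 'k) monoid_scheme \<Rightarrow> ('b, 'l) monoid_scheme \<Rightarrow> ('c, 'm) monoid_scheme \<Rightarrow>
     ('a \<Rightarrow> 'b) \<Rightarrow> ('b \<Rightarrow> 'c) \<Rightarrow> bool"
  where "short_exact A B C f g \<longleftrightarrow>
    group A \<and> group B \<and> group C \<and> f \<in> mon A B \<and> g \<in> epi B C \<and> f ` carrier A = kernel B C g"


section \<open>The braid group is a group, and \<open>p\<close> is a homomorphism\<close>

lemma braid_words_append [simp]:
  "v @ w \<in> braid_words n \<longleftrightarrow> v \<in> braid_words n \<and> w \<in> braid_words n"
  by (auto simp: braid_words_def)

lemma braid_rel_words: "(v, w) \<in> braid_rel n \<Longrightarrow> v \<in> braid_words n \<and> w \<in> braid_words n"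
  by (induction rule: braid_rel.induct) (auto, auto simp: braid_words_def)

lemma equiv_braid_rel: "equiv (braid_words n) (braid_rel n)"
proof (rule equivI)
  show "braid_rel n \<subseteq> braid_words n \<times> braid_words n"
    by (auto dest: braid_rel_words)
  show "refl_on (braid_words n) (braid_rel n)"
    by (simp add: refl_on_def braid_rel.refl)
  show "sym (braid_rel n)"
    by (rule symI) (rule braid_rel.sym)
  show "trans (braid_rel n)"
    by (rule transI) (rule braid_rel.trans)
qed

lemma braid_class_eq_iff:
  "v \<in> braid_words n \<Longrightarrow> w \<in> braid_words n \<Longrightarrow>
    braid_class n v = braid_class n w \<longleftrightarrow> (v, w) \<in> braid_rel n"
  unfolding braid_class_def by (rule eq_equiv_class_iff[OF equiv_braid_rel])

lemma carrier_braid_group: "carrier (braid_group n) = braid_class n ` braid_words n"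
  by (auto simp: braid_group_def quotient_def braid_class_def)

lemma one_braid_group: "\<one>\<^bsub>braid_group n\<^esub> = braid_class n []"
  by (simp add: braid_group_def)

lemma mult_braid_class:
  assumes "v \<in> braid_words n" "w \<in> braid_words n"
  shows "braid_class n v \<otimes>\<^bsub>braid_group n\<^esub> braid_class n w = braid_class n (v @ w)"
proof -
  have eq: "braid_class n (x @ y) = braid_class n (v @ w)"
    if "x \<in> braid_class n v" "y \<in> braid_class n w" for x y
  proof -
    have "(v @ w, x @ y) \<in> braid_rel n"
      using that by (auto simp: braid_class_def intro: braid_rel.append)
    then show ?thesis
      by (metis braid_class_eq_iff braid_rel_words)
  qed
  have "(\<Union>x\<in>braid_class n v. \<Union>y\<in>braid_class n w. braid_class n (x @ y)) =
      (\<Union>x\<in>braid_class n v. \<Union>y\<in>braid_class n w. braid_class n (v @ w))"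
    by (intro SUP_cong HOL.refl eq)
  moreover have "v \<in> braid_class n v" "w \<in> braid_class n w"
    using assms by (auto simp: braid_class_def intro: braid_rel.refl)
  ultimately show ?thesis
    by (auto simp: braid_group_def)
qed

definition word_inverse :: "braid_word \<Rightarrow> braid_word"
  where "word_inverse w = rev (map (\<lambda>(i, e). (i, \<not> e)) w)"

lemma word_inverse_in: "w \<in> braid_words n \<Longrightarrow> word_inverse w \<in> braid_words n"
  by (auto simp: word_inverse_def braid_words_def)

lemma word_inverse_rel: "w \<in> braid_words n \<Longrightarrow> (word_inverse w @ w, []) \<in> braid_rel n"
proof (induction w)
  case Nil
  then show ?case by (simp add: word_inverse_def braid_rel.refl)
next
  case (Cons l w)
  obtain i e where l: "l = (i, e)" by force
  have i: "1 \<le> i" "i < n" and w: "w \<in> braid_words n"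
    using Cons.prems by (auto simp: braid_words_def l)
  have "(word_inverse w @ [(i, \<not> e), (i, \<not> \<not> e)] @ w, word_inverse w @ [] @ w) \<in> braid_rel n"
    by (intro braid_rel.append braid_rel.refl braid_rel.cancel i w word_inverse_in)
  then show ?case
    using braid_rel.trans[OF _ Cons.IH[OF w]] by (simp add: word_inverse_def l)
qed

lemma group_braid_group: "group (braid_group n)"
proof (rule groupI)
  have nil: "[] \<in> braid_words n" by (simp add: braid_words_def)
  then show "\<one>\<^bsub>braid_group n\<^esub> \<in> carrier (braid_group n)"
    by (simp add: carrier_braid_group one_braid_group)
  fix x y z
  assume "x \<in> carrier (braid_group n)"
  then obtain u where u: "u \<in> braid_words n" "x = braid_class n u"
    by (auto simp: carrier_braid_group)
  show "\<one>\<^bsub>braid_group n\<^esub> \<otimes>\<^bsub>braid_group n\<^esub> x = x"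
    using u nil by (simp add: one_braid_group mult_braid_class)
  have "braid_class n (word_inverse u) \<otimes>\<^bsub>braid_group n\<^esub> x = \<one>\<^bsub>braid_group n\<^esub>"
    using u nil word_inverse_in[OF u(1)] word_inverse_rel[OF u(1)]
    by (simp add: one_braid_group mult_braid_class braid_class_eq_iff)
  then show "\<exists>y\<in>carrier (braid_group n). y \<otimes>\<^bsub>braid_group n\<^esub> x = \<one>\<^bsub>braid_group n\<^esub>"
    using word_inverse_in[OF u(1)] by (auto simp: carrier_braid_group)
  assume "y \<in> carrier (braid_group n)"
  then obtain v where v: "v \<in> braid_words n" "y = braid_class n v"
    by (auto simp: carrier_braid_group)
  show "x \<otimes>\<^bsub>braid_group n\<^esub> y \<in> carrier (braid_group n)"
    using u v by (simp add: mult_braid_class carrier_braid_group)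
  assume "z \<in> carrier (braid_group n)"
  then obtain w where w: "w \<in> braid_words n" "z = braid_class n w"
    by (auto simp: carrier_braid_group)
  show "x \<otimes>\<^bsub>braid_group n\<^esub> y \<otimes>\<^bsub>braid_group n\<^esub> z =
      x \<otimes>\<^bsub>braid_group n\<^esub> (y \<otimes>\<^bsub>braid_group n\<^esub> z)"
    using u v w by (simp add: mult_braid_class)
qed

lemma word_perm_append: "word_perm (v @ w) = word_perm v \<circ> word_perm w"
  by (induction v rule: word_perm.induct) (simp_all add: comp_assoc)

lemma word_perm_permutes: "w \<in> braid_words n \<Longrightarrow> word_perm w permutes {1..n}"
proof (induction w rule: word_perm.induct)
  case 1
  show ?case by (simp only: word_perm.simps permutes_id)
next
  case (2 i e w)
  have "i \<in> {1..n}" "i + 1 \<in> {1..n}" and w: "w \<in> braid_words n"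
    using "2.prems" by (simp_all add: braid_words_def)
  then have "transpose i (i + 1) permutes {1..n}"
    by (intro permutes_swap_id)
  from permutes_compose[OF "2.IH"[OF w] this] show ?case
    by (simp only: word_perm.simps)
qed

lemma word_perm_cong: "(v, w) \<in> braid_rel n \<Longrightarrow> word_perm v = word_perm w"
proof (induction rule: braid_rel.induct)
  case (commute i j)
  have "transpose i (i + 1) \<circ> transpose j (j + 1) = transpose j (j + 1) \<circ> transpose i (i + 1)"
    using commute.hyps by (intro ext) (simp add: transpose_def)
  then show ?case by simp
next
  case (braid i)
  have "transpose i (i + 1) \<circ> (transpose (i + 1) (i + 2) \<circ> transpose i (i + 1)) =
      transpose (i + 1) (i + 2) \<circ> (transpose i (i + 1) \<circ> transpose (i + 1) (i + 2))"
    by (intro ext) (simp add: transpose_def)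
  then show ?case by simp
next
  case (cancel i e)
  then show ?case by simp
next
  case (append v w v' w')
  then show ?case by (simp add: word_perm_append)
qed simp_all

lemma braid_perm_class:
  assumes "w \<in> braid_words n"
  shows "braid_perm (braid_class n w) = word_perm w"
proof -
  have "w \<in> braid_class n w"
    using assms by (simp add: braid_class_def braid_rel.refl)
  moreover have "word_perm v = word_perm w" if "v \<in> braid_class n w" for v
    using that word_perm_cong[of w v n] by (simp add: braid_class_def)
  ultimately have "word_perm ` braid_class n w = {word_perm w}"
    by blast
  then show ?thesis by (simp add: braid_perm_def)
qed

lemma braid_perm_hom: "braid_perm \<in> hom (braid_group n) (sym_group n)"
proof (rule homI)
  fix x assume "x \<in> carrier (braid_group n)"
  then obtain v where v: "v \<in> braid_words n" "x = braid_class n v"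
    by (auto simp: carrier_braid_group)
  then show "braid_perm x \<in> carrier (sym_group n)"
    by (simp only: braid_perm_class sym_group_carrier word_perm_permutes)
  fix y assume "y \<in> carrier (braid_group n)"
  then obtain w where w: "w \<in> braid_words n" "y = braid_class n w"
    by (auto simp: carrier_braid_group)
  show "braid_perm (x \<otimes>\<^bsub>braid_group n\<^esub> y) = braid_perm x \<otimes>\<^bsub>sym_group n\<^esub> braid_perm y"
    using v w by (simp add: mult_braid_class braid_perm_class word_perm_append sym_group_mult)
qed

lemma braid_perm_sigma: "1 \<le> i \<Longrightarrow> i < n \<Longrightarrow> braid_perm (braid_sigma n i) = transpose i (i + 1)"
  by (simp add: braid_sigma_def braid_perm_class braid_words_def)

end

theory Submission
  imports Defs
begin

text \<open>
  Write \<open>P\<close> for the pure braid group, \<open>N\<close> for the graphic kernel and \<open>p\<close> for the map to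
  permutations. Once \<open>N\<close> is known to be normal in the preimage of the automorphism group, the
  sequence is the third-isomorphism pattern \<open>K/N \<rightarrow> G/N \<rightarrow> H\<close> attached to a surjection \<open>G \<rightarrow> H\<close> with
  kernel \<open>K \<supseteq> N\<close> (\<open>short_exact_quotients\<close>). A coset of \<open>N\<close> is the same set whether it is formed
  in \<open>K\<close> or in \<open>G\<close>, so the first map is the identity on cosets. Surjectivity holds because
  adjacent transpositions generate the symmetric group (\<open>adjacent_transpositions_generate\<close>).

  The substance is the normality of \<open>N\<close>, which is only defined as a normal closure inside \<open>P\<close>.
  It suffices that conjugating a generator \<open>a\<^sub>i\<^sub>j\<close> of \<open>N\<close> by a braid over a graph automorphism gives
  an element of \<open>N\<close> (\<open>normal_closure_in_overgroup\<close>). Instead of computing \<open>\<sigma>\<^sub>k a\<^sub>i\<^sub>j \<sigma>\<^sub>k\<^sup>-\<^sup>1\<close> for all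
  relative positions of \<open>i\<close>, \<open>j\<close>, \<open>k\<close>, one observes that every \<open>a\<^sub>i\<^sub>j\<close> is a conjugate
  \<open>g \<sigma>\<^sub>1\<^sup>2 g\<^sup>-\<^sup>1\<close> with \<open>p g\<close> sending \<open>1, 2\<close> to \<open>i, j\<close>
  (\<open>pure_braid_gen_eq_full_twist_conjugate\<close>), and that the \<open>P\<close>-conjugacy class of
  \<open>g \<sigma>\<^sub>1\<^sup>2 g\<^sup>-\<^sup>1\<close> depends only on the image of \<open>{1, 2}\<close> under \<open>p g\<close>
  (\<open>conjugates_of_full_twist\<close>). The latter holds because the
  stabiliser of \<open>{1, 2}\<close> is generated by the transpositions \<open>(1,2)\<close> and \<open>(k,k+1)\<close> with \<open>k \<ge> 3\<close>,
  which lift to braids commuting with \<open>\<sigma>\<^sub>1\<close>. Hence a braid over an automorphism \<open>s\<close> carries \<open>a\<^sub>i\<^sub>j\<close>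
  to a \<open>P\<close>-conjugate of the generator belonging to \<open>{s i, s j}\<close>, and \<open>s\<close> maps non-edges to
  non-edges because it permutes the finite set of edges.
\<close>

section \<open>Normal closures and quotient sequences\<close>

lemma normal_closure_superset: "S \<subseteq> normal_closure G S"
  by (auto simp: normal_closure_def)

lemma normal_closure_least: "K \<lhd> G \<Longrightarrow> S \<subseteq> K \<Longrightarrow> normal_closure G S \<subseteq> K"
  by (auto simp: normal_closure_def)

lemma (in group) normal_closure_normal:
  assumes "S \<subseteq> carrier G"
  shows "normal_closure G S \<lhd> G"
proof (rule normal_invI)
  have "carrier G \<lhd> G"
    by (rule normal_invI[OF subgroup_self]) simp
  then show "subgroup (normal_closure G S) G"
    unfolding normal_closure_def using assms
    by (intro subgroups_Inter) (auto dest: normal_imp_subgroup)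
  fix x h assume "x \<in> carrier G" "h \<in> normal_closure G S"
  then show "x \<otimes> h \<otimes> inv x \<in> normal_closure G S"
    by (auto simp: normal_closure_def normal_inv_iff)
qed

lemma (in group) conjugation_hom:
  assumes P: "P \<lhd> G" and b: "b \<in> carrier G"
  shows "(\<lambda>x. b \<otimes> x \<otimes> inv b) \<in> hom (G\<lparr>carrier := P\<rparr>) (G\<lparr>carrier := P\<rparr>)"
proof (rule homI)
  have sub: "P \<subseteq> carrier G"
    using P by (simp add: normal_imp_subgroup subgroup.subset)
  fix x y assume x: "x \<in> carrier (G\<lparr>carrier := P\<rparr>)"
  then show "b \<otimes> x \<otimes> inv b \<in> carrier (G\<lparr>carrier := P\<rparr>)"
    using P b by (simp add: normal_inv_iff)
  assume y: "y \<in> carrier (G\<lparr>carrier := P\<rparr>)"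
  have "x \<in> carrier G" "y \<in> carrier G" using x y sub by auto
  moreover have "inv b \<otimes> (b \<otimes> z) = z" if "z \<in> carrier G" for z
    using that b by (simp add: m_assoc[symmetric])
  ultimately show "b \<otimes> (x \<otimes>\<^bsub>G\<lparr>carrier := P\<rparr>\<^esub> y) \<otimes> inv b =
      (b \<otimes> x \<otimes> inv b) \<otimes>\<^bsub>G\<lparr>carrier := P\<rparr>\<^esub> (b \<otimes> y \<otimes> inv b)"
    using b by (simp add: m_assoc)
qed

text \<open>
  Conjugation by \<open>b\<close> is an endomorphism of \<open>P\<close>, so the elements of \<open>P\<close> that it maps into the
  closure form a normal subgroup of \<open>P\<close>; this subgroup contains \<open>S\<close>, hence the closure.
\<close>

lemma (in group) normal_closure_in_overgroup:
  assumes P: "P \<lhd> G" and S: "S \<subseteq> P"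
    and conj: "\<And>b s. b \<in> carrier G \<Longrightarrow> s \<in> S \<Longrightarrow>
      b \<otimes> s \<otimes> inv b \<in> normal_closure (G\<lparr>carrier := P\<rparr>) S"
  shows "normal_closure (G\<lparr>carrier := P\<rparr>) S \<lhd> G"
proof (rule normal_invI)
  let ?P = "G\<lparr>carrier := P\<rparr>" and ?N = "normal_closure (G\<lparr>carrier := P\<rparr>) S"
  have subP: "subgroup P G" using P by (rule normal_imp_subgroup)
  interpret P: group ?P using subP by (rule subgroup_imp_group)
  have N: "?N \<lhd> ?P" by (rule P.normal_closure_normal) (use S in simp)
  then have subN: "subgroup ?N ?P" by (rule normal_imp_subgroup)
  show "subgroup ?N G"
    using incl_subgroup[OF subP subN] .
  fix b x assume b: "b \<in> carrier G" and x: "x \<in> ?N"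
  let ?c = "\<lambda>x. b \<otimes> x \<otimes> inv b"
  interpret c: group_hom ?P ?P ?c
    by unfold_locales (rule conjugation_hom[OF P b])
  let ?K = "{x \<in> P. ?c x \<in> ?N}"
  have "?K \<lhd> ?P"
  proof (rule P.normal_invI)
    show "subgroup ?K ?P"
    proof (rule P.subgroupI)
      show "?K \<subseteq> carrier ?P" by auto
      show "?K \<noteq> {}"
        using subgroup.one_closed[OF subP] subgroup.one_closed[OF subN] c.hom_one by auto
    next
      fix a assume a: "a \<in> ?K"
      then show "inv\<^bsub>?P\<^esub> a \<in> ?K"
        using c.hom_inv[of a] subgroup.m_inv_closed[OF subN, of "?c a"] P.inv_closed[of a]
        by simp
    next
      fix a d assume "a \<in> ?K" "d \<in> ?K"
      then show "a \<otimes>\<^bsub>?P\<^esub> d \<in> ?K"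
        using c.hom_mult[of a d] subgroup.m_closed[OF subN, of "?c a" "?c d"] P.m_closed[of a d]
        by simp
    qed
    fix y h assume y: "y \<in> carrier ?P" and h: "h \<in> ?K"
    have hP: "h \<in> carrier ?P" and hN: "?c h \<in> ?N" using h by auto
    have "?c (y \<otimes>\<^bsub>?P\<^esub> h \<otimes>\<^bsub>?P\<^esub> inv\<^bsub>?P\<^esub> y) = ?c y \<otimes>\<^bsub>?P\<^esub> ?c h \<otimes>\<^bsub>?P\<^esub> inv\<^bsub>?P\<^esub> ?c y"
      using c.hom_mult[OF P.m_closed[OF y hP] P.inv_closed[OF y]] c.hom_mult[OF y hP]
        c.hom_inv[OF y] by simp
    also have "\<dots> \<in> ?N"
      using N c.hom_closed[OF y] hN unfolding P.normal_inv_iff by blast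
    finally show "y \<otimes>\<^bsub>?P\<^esub> h \<otimes>\<^bsub>?P\<^esub> inv\<^bsub>?P\<^esub> y \<in> ?K"
      using P.m_closed[OF P.m_closed[OF y hP] P.inv_closed[OF y]] by simp
  qed
  moreover have "S \<subseteq> ?K"
    using S conj[OF b] by auto
  ultimately show "?c x \<in> ?N"
    using normal_closure_least x by blast
qed

text \<open>
  The injection can be taken to be the identity because a coset of \<open>N\<close> by an element of the kernel
  is the same set in the kernel as in \<open>G\<close>.
\<close>

lemma (in group_hom) short_exact_quotients:
  assumes surj: "h ` carrier G = carrier H" and N: "N \<lhd> G" and NK: "N \<subseteq> kernel G H h"
  obtains g where "short_exact (G\<lparr>carrier := kernel G H h\<rparr> Mod N) (G Mod N) H id g"
    and "\<And>x. x \<in> carrier G \<Longrightarrow> g (N #> x) = h x"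
proof -
  let ?K = "G\<lparr>carrier := kernel G H h\<rparr>"
  obtain g where g: "g \<in> hom (G Mod N) H" and gh: "\<And>x. x \<in> carrier G \<Longrightarrow> g (N #> x) = h x"
    by (rule FactGroup_universal_kernel[OF N NK]) blast
  have NnK: "N \<lhd> ?K"
    using G.normal_restrict_supergroup[OF subgroup_kernel N NK] .
  have carr: "carrier (?K Mod N) = (\<lambda>x. N #> x) ` kernel G H h"
    by (simp add: carrier_FactGroup r_coset_def)
  have carrG: "carrier (G Mod N) = (\<lambda>x. N #> x) ` carrier G"
    by (rule carrier_FactGroup)
  have sub: "kernel G H h \<subseteq> carrier G"
    by (auto simp: kernel_def)
  have "id \<in> mon (?K Mod N) (G Mod N)"
    using sub by (auto simp: mon_def hom_def carr carrG set_mult_def)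
  moreover have "g \<in> epi (G Mod N) H"
    using g surj by (simp add: epi_def carrG image_image gh cong: image_cong_simp)
  moreover have "id ` carrier (?K Mod N) = kernel (G Mod N) H g"
    unfolding image_id id_apply carr using gh by (auto simp: carrG kernel_def)
  ultimately have "short_exact (?K Mod N) (G Mod N) H id g"
    using normal.factorgroup_is_group[OF N] normal.factorgroup_is_group[OF NnK] H.group_axioms
    by (simp add: short_exact_def)
  then show thesis using gh that by blast
qed

text \<open>
  The element \<open>x = b d\<^sup>-\<^sup>1 c\<^sup>-\<^sup>1\<close> does it: its image is trivial, and \<open>d\<close> disappears from the
  conjugate because it commutes with \<open>z\<close>.
\<close>

lemma (in group_hom) kernel_conjugate_if_centralizer_lift:
  assumes "z \<in> carrier G" "b \<in> carrier G" "c \<in> carrier G" "d \<in> carrier G"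
    and comm: "d \<otimes> z = z \<otimes> d" and hd: "h c \<otimes>\<^bsub>H\<^esub> h d = h b"
  shows "\<exists>x\<in>kernel G H h. b \<otimes> z \<otimes> inv b = x \<otimes> (c \<otimes> z \<otimes> inv c) \<otimes> inv x"
proof
  let ?x = "b \<otimes> inv d \<otimes> inv c"
  have "h ?x = h b \<otimes>\<^bsub>H\<^esub> inv\<^bsub>H\<^esub> (h c \<otimes>\<^bsub>H\<^esub> h d)"
    using assms(1-4) by (simp add: H.inv_mult_group H.m_assoc)
  then have "h ?x = \<one>\<^bsub>H\<^esub>"
    using assms(2) by (simp add: hd)
  then show "?x \<in> kernel G H h"
    using assms(1-4) by (simp add: kernel_def)
  have cancel: "inv c \<otimes> (c \<otimes> y) = y" if "y \<in> carrier G" for y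
    using that assms(3) by (simp add: G.m_assoc[symmetric])
  have "inv d \<otimes> (z \<otimes> (d \<otimes> inv b)) = inv d \<otimes> (d \<otimes> (z \<otimes> inv b))"
    using assms(1-4) by (simp add: G.m_assoc[symmetric] comm)
  also have "\<dots> = z \<otimes> inv b"
    using assms(1-4) by (simp add: G.m_assoc[symmetric])
  finally show "b \<otimes> z \<otimes> inv b = ?x \<otimes> (c \<otimes> z \<otimes> inv c) \<otimes> inv ?x"
    using assms(1-4) by (simp add: G.inv_mult_group G.m_assoc cancel)
qed


section \<open>Lifting permutations to braids\<close>

lemma transpose_positive_word:
  assumes "a < b"
  shows "\<exists>w\<in>lists ({a..<b} \<times> {True}). word_perm w = transpose a b"
  using Suc_leI[OF assms]
proof (induction b rule: dec_induct)
  case base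
  show ?case by (intro bexI[of _ "[(a, True)]"]) auto
next
  case (step b)
  then obtain w where w: "w \<in> lists ({a..<b} \<times> {True})" "word_perm w = transpose a b"
    by blast
  have "word_perm ([(b, True)] @ w @ [(b, True)]) = transpose a (Suc b)"
    using step.hyps by (simp add: word_perm_append w(2) fun_eq_iff transpose_def)
  moreover have "[(b, True)] @ w @ [(b, True)] \<in> lists ({a..<Suc b} \<times> {True})"
    using w(1) step.hyps by (auto simp: less_SucI)
  ultimately show ?case by blast
qed

lemma adjacent_transpositions_generate:
  assumes "s permutes {m..n}"
  shows "\<exists>w\<in>lists ({m..<n} \<times> {True}). word_perm w = s"
  using assms finite_atLeastAtMost
proof (induction rule: permutes_induct)
  case id
  show ?case by (intro bexI[of _ "[]"]) auto
next
  case (swap a b s)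
  obtain v where v: "v \<in> lists ({m..<n} \<times> {True})" "word_perm v = transpose a b"
  proof -
    have "min a b < max a b" "m \<le> min a b" "max a b \<le> n"
      using swap.hyps by auto
    moreover from transpose_positive_word[OF this(1)]
    obtain v where "v \<in> lists ({min a b..<max a b} \<times> {True})"
      and "word_perm v = transpose (min a b) (max a b)" by blast
    moreover have "transpose (min a b) (max a b) = transpose a b"
      by (cases "a \<le> b") (simp_all add: transpose_commute)
    ultimately show thesis using that[of v] lists_mono[of "{min a b..<max a b} \<times> {True}" "{m..<n} \<times> {True}"]
      by fastforce
  qed
  obtain w where w: "w \<in> lists ({m..<n} \<times> {True})" "word_perm w = s"
    using swap.IH by blast
  show ?case
    by (intro bexI[of _ "v @ w"]) (use v w in \<open>auto simp: word_perm_append\<close>)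
qed

interpretation braid: group_hom "braid_group n" "sym_group n" braid_perm for n
  by (intro group_hom.intro group_hom_axioms.intro group_braid_group sym_group_is_group
      braid_perm_hom)

lemma positive_words_subset: "1 \<le> m \<Longrightarrow> lists ({m..<n} \<times> {True}) \<subseteq> braid_words n"
  by (auto simp: braid_words_def)

lemma braid_class_closed: "w \<in> braid_words n \<Longrightarrow> braid_class n w \<in> carrier (braid_group n)"
  by (simp add: carrier_braid_group)

lemma braid_sigma_closed: "1 \<le> i \<Longrightarrow> i < n \<Longrightarrow> braid_sigma n i \<in> carrier (braid_group n)"
  by (simp add: braid_sigma_def braid_class_closed braid_words_def)

lemma braid_perm_mult:
  "b \<in> carrier (braid_group n) \<Longrightarrow> c \<in> carrier (braid_group n) \<Longrightarrow>
    braid_perm (b \<otimes>\<^bsub>braid_group n\<^esub> c) = braid_perm b \<circ> braid_perm c"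
  by (simp add: sym_group_mult)

lemma braid_perm_permutes: "b \<in> carrier (braid_group n) \<Longrightarrow> braid_perm b permutes {1..n}"
  using braid.hom_closed[of b n] by (simp add: sym_group_carrier)

lemma braid_perm_surj:
  assumes "s permutes {1..n}"
  shows "\<exists>b\<in>carrier (braid_group n). braid_perm b = s"
  using adjacent_transpositions_generate[OF assms] positive_words_subset[of 1 n]
    braid_perm_class braid_class_closed by blast

lemma far_word_commutes_sigma1:
  assumes "1 < n" "w \<in> lists ({3..<n} \<times> {True})"
  shows "(w @ [(1, True)], [(1, True)] @ w) \<in> braid_rel n"
  using assms(2)
proof (induction w)
  case Nil
  show ?case
    using assms(1) by (auto simp: braid_words_def intro: braid_rel.refl)
next
  case (Cons l w)
  then obtain j where j: "l = (j, True)" "3 \<le> j" "j < n"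
    by auto
  have w: "w \<in> braid_words n"
    using Cons.hyps(2) by (rule subsetD[OF positive_words_subset, rotated]) simp
  have l: "[l] \<in> braid_words n"
    using j by (simp add: braid_words_def)
  have "([l] @ (w @ [(1, True)]), [l] @ ([(1, True)] @ w)) \<in> braid_rel n"
    by (rule braid_rel.append[OF braid_rel.refl[OF l] Cons.IH])
  then have 1: "((l # w) @ [(1, True)], l # (1, True) # w) \<in> braid_rel n"
    by simp
  have "([(j, True), (1, True)], [(1, True), (j, True)]) \<in> braid_rel n"
    by (rule braid_rel.sym[OF braid_rel.commute]) (use j in auto)
  from braid_rel.append[OF this braid_rel.refl[OF w]]
  have 2: "(l # (1, True) # w, [(1, True)] @ (l # w)) \<in> braid_rel n"
    by (simp add: j(1))
  show ?case
    by (rule braid_rel.trans[OF 1 2])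
qed

text \<open>
  After multiplying by \<open>(1,2)\<close> if necessary, \<open>s\<close> fixes \<open>1\<close> and \<open>2\<close>, so it is a product of
  transpositions \<open>(k,k+1)\<close> with \<open>k \<ge> 3\<close>; the corresponding \<open>\<sigma>\<^sub>k\<close> are far from \<open>\<sigma>\<^sub>1\<close>.
\<close>

lemma stabilizer_lift_commutes_sigma1:
  assumes n: "1 < n" and s: "s permutes {1..n}" and stab: "s ` {1, 2} = {1, 2}"
  shows "\<exists>d\<in>carrier (braid_group n). braid_perm d = s \<and>
    d \<otimes>\<^bsub>braid_group n\<^esub> braid_sigma n 1 = braid_sigma n 1 \<otimes>\<^bsub>braid_group n\<^esub> d"
proof -
  let ?\<sigma> = "braid_sigma n 1"
  have \<sigma>: "?\<sigma> \<in> carrier (braid_group n)" using n by (simp add: braid_sigma_closed)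
  have fixing: "\<exists>d\<in>carrier (braid_group n). braid_perm d = t \<and>
      d \<otimes>\<^bsub>braid_group n\<^esub> ?\<sigma> = ?\<sigma> \<otimes>\<^bsub>braid_group n\<^esub> d"
    if t: "t permutes {1..n}" and "t 1 = 1" "t 2 = 2" for t
  proof -
    have "t permutes {3..n}"
      by (rule permutes_superset[OF t])
        (use that(2,3) in \<open>auto simp: numeral_3_eq_3 numeral_2_eq_2 not_less_eq_eq le_Suc_eq\<close>)
    then obtain w where w: "w \<in> lists ({3..<n} \<times> {True})" "word_perm w = t"
      using adjacent_transpositions_generate by blast
    have wn: "w \<in> braid_words n" by (rule subsetD[OF positive_words_subset w(1)]) simp
    have 1: "[(1, True)] \<in> braid_words n" using n by (simp add: braid_words_def)
    have "braid_class n (w @ [(1, True)]) = braid_class n ([(1, True)] @ w)"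
      by (subst braid_class_eq_iff) (simp_all only: far_word_commutes_sigma1[OF n w(1)] wn 1
          braid_words_append simp_thms)
    then have "braid_class n w \<otimes>\<^bsub>braid_group n\<^esub> ?\<sigma> = ?\<sigma> \<otimes>\<^bsub>braid_group n\<^esub> braid_class n w"
      by (simp only: braid_sigma_def mult_braid_class wn 1)
    then show ?thesis
      using wn w(2) braid_perm_class[OF wn] braid_class_closed[OF wn] by blast
  qed
  have "inj s" using s by (rule permutes_inj)
  then have "s 1 \<noteq> s 2" by (simp add: inj_eq)
  moreover have "s 1 \<in> {1, 2}" "s 2 \<in> {1, 2}" using stab by blast+
  ultimately consider "s 1 = 1" "s 2 = 2" | "s 1 = 2" "s 2 = 1"
    by auto
  then show ?thesis
  proof cases
    case 1
    then show ?thesis using fixing[OF s] by blast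
  next
    case 2
    let ?\<tau> = "transpose 1 (1 + 1 :: nat)"
    have "?\<tau> permutes {1..n}" by (rule permutes_swap_id) (use n in auto)
    then have "s \<circ> ?\<tau> permutes {1..n}" using s by (rule permutes_compose)
    moreover have "(s \<circ> ?\<tau>) 1 = 1" "(s \<circ> ?\<tau>) 2 = 2"
      using 2 by (simp_all add: transpose_def numeral_2_eq_2)
    ultimately obtain d where d: "d \<in> carrier (braid_group n)"
      "braid_perm d = s \<circ> ?\<tau>" "d \<otimes>\<^bsub>braid_group n\<^esub> ?\<sigma> = ?\<sigma> \<otimes>\<^bsub>braid_group n\<^esub> d"
      using fixing[of "s \<circ> ?\<tau>"] by blast
    have "braid_perm (d \<otimes>\<^bsub>braid_group n\<^esub> ?\<sigma>) = s"
      using braid_perm_mult[OF d(1) \<sigma>] braid_perm_sigma[of 1 n] n d(2) by (simp add: comp_assoc)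
    moreover have "(d \<otimes>\<^bsub>braid_group n\<^esub> ?\<sigma>) \<otimes>\<^bsub>braid_group n\<^esub> ?\<sigma> =
        ?\<sigma> \<otimes>\<^bsub>braid_group n\<^esub> (d \<otimes>\<^bsub>braid_group n\<^esub> ?\<sigma>)"
      using d(1,3) \<sigma> by (metis braid.G.m_assoc)
    ultimately show ?thesis using d(1) \<sigma> by blast
  qed
qed


section \<open>Conjugates of the full twist on two strands\<close>

definition full_twist_conjugate :: "nat \<Rightarrow> braid_word set \<Rightarrow> braid_word set"
  where "full_twist_conjugate n b = b \<otimes>\<^bsub>braid_group n\<^esub>
    (braid_sigma n 1 \<otimes>\<^bsub>braid_group n\<^esub> braid_sigma n 1) \<otimes>\<^bsub>braid_group n\<^esub> inv\<^bsub>braid_group n\<^esub> b"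

lemma conjugate_full_twist_conjugate:
  assumes "1 < n" "b \<in> carrier (braid_group n)" "c \<in> carrier (braid_group n)"
  shows "b \<otimes>\<^bsub>braid_group n\<^esub> full_twist_conjugate n c \<otimes>\<^bsub>braid_group n\<^esub> inv\<^bsub>braid_group n\<^esub> b =
    full_twist_conjugate n (b \<otimes>\<^bsub>braid_group n\<^esub> c)"
  using assms braid_sigma_closed[of 1 n]
  by (simp add: full_twist_conjugate_def braid.G.m_assoc braid.G.inv_mult_group)

text \<open>
  The permutations of \<open>b\<close> and \<open>c\<close> differ by a right factor stabilising \<open>{1, 2}\<close>, and this factor
  lifts to the centraliser of the full twist \<open>\<sigma>\<^sub>1\<^sup>2\<close>.
\<close>

lemma conjugates_of_full_twist:
  assumes n: "1 < n" and b: "b \<in> carrier (braid_group n)" and c: "c \<in> carrier (braid_group n)"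
    and eq: "braid_perm b ` {1, 2} = braid_perm c ` {1, 2}"
  shows "\<exists>x\<in>kernel (braid_group n) (sym_group n) braid_perm.
    full_twist_conjugate n b = x \<otimes>\<^bsub>braid_group n\<^esub> full_twist_conjugate n c \<otimes>\<^bsub>braid_group n\<^esub>
      inv\<^bsub>braid_group n\<^esub> x"
proof -
  let ?\<sigma> = "braid_sigma n 1" and ?s = "inv_into UNIV (braid_perm c) \<circ> braid_perm b"
  have \<sigma>: "?\<sigma> \<in> carrier (braid_group n)" using n by (simp add: braid_sigma_closed)
  note pb = braid_perm_permutes[OF b] and pc = braid_perm_permutes[OF c]
  have "?s permutes {1..n}"
    by (rule permutes_compose[OF pb permutes_inv[OF pc]])
  moreover have "?s ` {1, 2} = {1, 2}"
    unfolding image_comp[symmetric] eq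
    by (simp only: image_comp permutes_inv_o[OF pc] image_id id_apply)
  ultimately obtain d where d: "d \<in> carrier (braid_group n)" "braid_perm d = ?s"
    "d \<otimes>\<^bsub>braid_group n\<^esub> ?\<sigma> = ?\<sigma> \<otimes>\<^bsub>braid_group n\<^esub> d"
    using stabilizer_lift_commutes_sigma1[OF n] by blast
  have "d \<otimes>\<^bsub>braid_group n\<^esub> (?\<sigma> \<otimes>\<^bsub>braid_group n\<^esub> ?\<sigma>) = (?\<sigma> \<otimes>\<^bsub>braid_group n\<^esub> d) \<otimes>\<^bsub>braid_group n\<^esub> ?\<sigma>"
    using d \<sigma> by (metis braid.G.m_assoc)
  also have "\<dots> = (?\<sigma> \<otimes>\<^bsub>braid_group n\<^esub> ?\<sigma>) \<otimes>\<^bsub>braid_group n\<^esub> d"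
    using d \<sigma> by (metis braid.G.m_assoc)
  finally have comm: "d \<otimes>\<^bsub>braid_group n\<^esub> (?\<sigma> \<otimes>\<^bsub>braid_group n\<^esub> ?\<sigma>) =
      (?\<sigma> \<otimes>\<^bsub>braid_group n\<^esub> ?\<sigma>) \<otimes>\<^bsub>braid_group n\<^esub> d" .
  have "braid_perm c \<circ> braid_perm d = braid_perm b"
    by (simp add: d(2) comp_assoc[symmetric] permutes_inv_o[OF pc])
  then show ?thesis
    unfolding full_twist_conjugate_def
    by (intro braid.kernel_conjugate_if_centralizer_lift[OF _ b c d(1) comm])
      (use \<sigma> in \<open>simp_all add: sym_group_mult\<close>)
qed

text \<open>The braid relation says that \<open>\<sigma>\<^sub>i\<^sub>+\<^sub>1\<close> is the conjugate of \<open>\<sigma>\<^sub>i\<close> by \<open>\<sigma>\<^sub>i \<sigma>\<^sub>i\<^sub>+\<^sub>1\<close>.\<close>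

lemma sigma_conjugate_sigma1:
  assumes "1 \<le> i" "i < n"
  shows "\<exists>g\<in>carrier (braid_group n). braid_perm g 1 = i \<and> braid_perm g 2 = i + 1 \<and>
    braid_sigma n i \<otimes>\<^bsub>braid_group n\<^esub> g = g \<otimes>\<^bsub>braid_group n\<^esub> braid_sigma n 1"
  using assms
proof (induction i rule: dec_induct)
  case base
  then show ?case
    using braid_sigma_closed[of 1 n] braid.hom_one[of n]
    by (intro bexI[of _ "\<one>\<^bsub>braid_group n\<^esub>"]) (simp_all add: sym_group_one)
next
  case (step i)
  let ?G = "braid_group n" and ?s = "braid_sigma n i" and ?t = "braid_sigma n (Suc i)"
  obtain g where g: "g \<in> carrier ?G" "braid_perm g 1 = i" "braid_perm g 2 = i + 1"
    "?s \<otimes>\<^bsub>?G\<^esub> g = g \<otimes>\<^bsub>?G\<^esub> braid_sigma n 1"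
    using step by auto
  have s: "?s \<in> carrier ?G" and t: "?t \<in> carrier ?G" and one: "braid_sigma n 1 \<in> carrier ?G"
    using step by (auto intro: braid_sigma_closed)
  have rel: "?t \<otimes>\<^bsub>?G\<^esub> (?s \<otimes>\<^bsub>?G\<^esub> ?t) = ?s \<otimes>\<^bsub>?G\<^esub> (?t \<otimes>\<^bsub>?G\<^esub> ?s)"
    using step braid_rel.braid[of i n]
    by (simp add: braid_sigma_def mult_braid_class braid_words_def braid_class_eq_iff
        braid_rel.sym)
  let ?h = "?s \<otimes>\<^bsub>?G\<^esub> ?t \<otimes>\<^bsub>?G\<^esub> g"
  have "?t \<otimes>\<^bsub>?G\<^esub> ?h = (?t \<otimes>\<^bsub>?G\<^esub> (?s \<otimes>\<^bsub>?G\<^esub> ?t)) \<otimes>\<^bsub>?G\<^esub> g"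
    using s t g(1) by (simp add: braid.G.m_assoc)
  also have "\<dots> = ?s \<otimes>\<^bsub>?G\<^esub> (?t \<otimes>\<^bsub>?G\<^esub> (?s \<otimes>\<^bsub>?G\<^esub> g))"
    using s t g(1) by (simp add: rel braid.G.m_assoc)
  also have "\<dots> = ?h \<otimes>\<^bsub>?G\<^esub> braid_sigma n 1"
    using s t g(1) one by (simp add: g(4) braid.G.m_assoc)
  finally have "?t \<otimes>\<^bsub>?G\<^esub> ?h = ?h \<otimes>\<^bsub>?G\<^esub> braid_sigma n 1" .
  moreover have "braid_perm ?h = transpose i (i + 1) \<circ> transpose (Suc i) (Suc i + 1) \<circ> braid_perm g"
    using s t g(1) step by (simp add: sym_group_mult braid_perm_sigma)
  ultimately show ?case
    using s t g(1-3) by (intro bexI[of _ ?h]) (simp_all add: transpose_def)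
qed

lemma pure_braid_gen_Suc:
  assumes "1 \<le> i" "i < j" "j < n"
  shows "pure_braid_gen n i (Suc j) = braid_sigma n j \<otimes>\<^bsub>braid_group n\<^esub> pure_braid_gen n i j
    \<otimes>\<^bsub>braid_group n\<^esub> inv\<^bsub>braid_group n\<^esub> braid_sigma n j"
proof -
  let ?w = "map (\<lambda>k. (k, True)) (rev [i + 1..<j]) @ [(i, True), (i, True)] @
     map (\<lambda>k. (k, False)) [i + 1..<j]"
  have w: "?w \<in> braid_words n" and l: "[(j, e)] \<in> braid_words n" for e
    using assms by (auto simp: braid_words_def)
  have "([(j, False), (j, True)], []) \<in> braid_rel n"
    using braid_rel.cancel[of j n False] assms by simp
  then have "braid_class n [(j, False)] \<otimes>\<^bsub>braid_group n\<^esub> braid_sigma n j = \<one>\<^bsub>braid_group n\<^esub>"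
    using assms by (simp add: braid_sigma_def one_braid_group mult_braid_class braid_words_def
        braid_class_eq_iff)
  then have inv: "inv\<^bsub>braid_group n\<^esub> braid_sigma n j = braid_class n [(j, False)]"
    using assms l by (intro braid.G.inv_equality) (simp_all add: braid_sigma_closed braid_class_closed)
  have "pure_braid_gen n i (Suc j) = braid_class n ([(j, True)] @ ?w @ [(j, False)])"
    using assms by (simp add: pure_braid_gen_def)
  also have "\<dots> = braid_class n [(j, True)] \<otimes>\<^bsub>braid_group n\<^esub> braid_class n ?w
      \<otimes>\<^bsub>braid_group n\<^esub> braid_class n [(j, False)]"
    using w l by (simp only: mult_braid_class braid_words_append simp_thms append_assoc)
  finally show ?thesis
    by (simp only: inv) (simp only: braid_sigma_def pure_braid_gen_def)
qed

text \<open>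
  Going from \<open>j\<close> to \<open>j + 1\<close> conjugates \<open>a\<^sub>i\<^sub>j\<close> by \<open>\<sigma>\<^sub>j\<close>, which keeps strand \<open>i\<close> in place and moves
  \<open>j\<close> to \<open>j + 1\<close>; the starting point is \<open>\<sigma>\<^sub>i\<^sup>2\<close>.
\<close>

lemma pure_braid_gen_eq_full_twist_conjugate:
  assumes "1 \<le> i" "i < j" "j \<le> n"
  shows "\<exists>g\<in>carrier (braid_group n). braid_perm g 1 = i \<and> braid_perm g 2 = j \<and>
    pure_braid_gen n i j = full_twist_conjugate n g"
  using Suc_leI[OF assms(2)] assms(3)
proof (induction j rule: dec_induct)
  case base
  let ?G = "braid_group n" and ?\<sigma> = "braid_sigma n 1" and ?s = "braid_sigma n i"
  have one: "?\<sigma> \<in> carrier ?G" and s: "?s \<in> carrier ?G"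
    using assms by (auto intro: braid_sigma_closed)
  from sigma_conjugate_sigma1[of i n] obtain g where g: "g \<in> carrier ?G"
    "braid_perm g 1 = i" "braid_perm g 2 = i + 1" "?s \<otimes>\<^bsub>?G\<^esub> g = g \<otimes>\<^bsub>?G\<^esub> ?\<sigma>"
    using assms by auto
  have "g \<otimes>\<^bsub>?G\<^esub> (?\<sigma> \<otimes>\<^bsub>?G\<^esub> ?\<sigma>) = ?s \<otimes>\<^bsub>?G\<^esub> ?s \<otimes>\<^bsub>?G\<^esub> g"
    using g one s by (metis braid.G.m_assoc)
  then have "full_twist_conjugate n g = ?s \<otimes>\<^bsub>?G\<^esub> ?s"
    using g(1) s by (simp add: full_twist_conjugate_def braid.G.m_assoc)
  also have "\<dots> = pure_braid_gen n i (Suc i)"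
    using assms by (simp add: pure_braid_gen_def braid_sigma_def mult_braid_class braid_words_def)
  finally show ?case using g by auto
next
  case (step j)
  let ?G = "braid_group n" and ?s = "braid_sigma n j"
  obtain g where g: "g \<in> carrier ?G" "braid_perm g 1 = i" "braid_perm g 2 = j"
    "pure_braid_gen n i j = full_twist_conjugate n g"
    using step by auto
  have j: "i < j" "j < n" "1 \<le> j" using step assms by auto
  then have s: "?s \<in> carrier ?G" by (simp add: braid_sigma_closed)
  have "pure_braid_gen n i (Suc j) = full_twist_conjugate n (?s \<otimes>\<^bsub>?G\<^esub> g)"
    using pure_braid_gen_Suc[OF assms(1) j(1,2)] conjugate_full_twist_conjugate[OF _ s g(1)] g(4) j
    by simp
  moreover have "braid_perm (?s \<otimes>\<^bsub>?G\<^esub> g) = transpose j (j + 1) \<circ> braid_perm g"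
    using s g(1) j by (simp add: sym_group_mult braid_perm_sigma)
  ultimately show ?case
    using s g(1-3) j by (intro bexI[of _ "?s \<otimes>\<^bsub>?G\<^esub> g"]) (simp_all add: transpose_def)
qed


section \<open>The graphic braid group\<close>

text \<open>
  Automorphisms are only required to preserve edges; since there are finitely many edges, they
  permute them, and so reflect edges as well.
\<close>

lemma graph_aut_edge_iff:
  assumes E: "simple_graph n E" and s: "s \<in> carrier (graph_aut_group n E)"
  shows "{s i, s j} \<in> E \<longleftrightarrow> {i, j} \<in> E"
proof
  have perm: "s permutes {1..n}" and pres: "\<And>i j. {i, j} \<in> E \<Longrightarrow> {s i, s j} \<in> E"
    using s by (auto simp: graph_aut_group_def sym_group_carrier)
  have "finite E"
    by (rule finite_subset[of _ "Pow {1..n}"]) (use E in \<open>auto simp: simple_graph_def\<close>)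
  moreover have "(`) s ` E \<subseteq> E"
  proof (rule image_subsetI)
    fix e assume "e \<in> E"
    moreover from this obtain a b where "e = {a, b}"
      using E by (auto simp: simple_graph_def card_2_iff)
    ultimately show "s ` e \<in> E" using pres by simp
  qed
  moreover have inj: "inj ((`) s)"
    using permutes_inj[OF perm] by (simp add: inj_image_eq_iff inj_def)
  ultimately have "(`) s ` E = E"
    by (intro endo_inj_surj) (auto intro: inj_on_subset)
  moreover assume "{s i, s j} \<in> E"
  ultimately have "s ` {i, j} \<in> (`) s ` E" by simp
  then show "{i, j} \<in> E"
    using inj by (simp only: inj_image_mem_iff)
next
  assume "{i, j} \<in> E"
  then show "{s i, s j} \<in> E"
    using s by (auto simp: graph_aut_group_def)
qed

lemma graph_aut_subgroup:
  assumes "simple_graph n E"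
  shows "subgroup (carrier (graph_aut_group n E)) (sym_group n)"
proof -
  show ?thesis
  proof (rule braid.H.subgroupI)
    show "carrier (graph_aut_group n E) \<subseteq> carrier (sym_group n)"
      by (auto simp: graph_aut_group_def)
    have "id \<in> carrier (graph_aut_group n E)"
      using braid.H.one_closed by (simp add: graph_aut_group_def sym_group_one)
    then show "carrier (graph_aut_group n E) \<noteq> {}" by blast
  next
    fix s assume s: "s \<in> carrier (graph_aut_group n E)"
    then have sS: "s \<in> carrier (sym_group n)" by (simp add: graph_aut_group_def)
    then have "s (inv_into UNIV s i) = i" for i
      by (simp add: sym_group_carrier permutes_inverses)
    then show "inv\<^bsub>sym_group n\<^esub> s \<in> carrier (graph_aut_group n E)"
      using graph_aut_edge_iff[OF assms s, of "inv_into UNIV s i" "inv_into UNIV s j" for i j]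
        sS sym_group_inv_closed[OF sS]
      by (simp add: graph_aut_group_def)
  next
    fix s t assume st: "s \<in> carrier (graph_aut_group n E)" "t \<in> carrier (graph_aut_group n E)"
    then have "s \<otimes>\<^bsub>sym_group n\<^esub> t \<in> carrier (sym_group n)"
      by (intro braid.H.m_closed) (simp_all add: graph_aut_group_def)
    then show "s \<otimes>\<^bsub>sym_group n\<^esub> t \<in> carrier (graph_aut_group n E)"
      using st by (simp add: graph_aut_group_def sym_group_mult)
  qed
qed

lemma aut_braid_group_hom:
  assumes "simple_graph n E"
  shows "group_hom (aut_braid_group n E) (graph_aut_group n E) braid_perm"
    and "subgroup (carrier (aut_braid_group n E)) (braid_group n)"
    and "braid_perm ` carrier (aut_braid_group n E) = carrier (graph_aut_group n E)"
    and "aut_braid_group n E\<lparr>carrier :=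
      kernel (aut_braid_group n E) (graph_aut_group n E) braid_perm\<rparr> = pure_braid_group n"
proof -
  let ?A = "carrier (graph_aut_group n E)"
  let ?B = "carrier (aut_braid_group n E)"
  have A: "subgroup ?A (sym_group n)" by (rule graph_aut_subgroup[OF assms])
  have Adef: "graph_aut_group n E = (sym_group n)\<lparr>carrier := ?A\<rparr>"
    by (simp add: graph_aut_group_def)
  have Bdef: "aut_braid_group n E = (braid_group n)\<lparr>carrier := ?B\<rparr>"
    by (simp add: aut_braid_group_def)
  have Bmem: "b \<in> ?B \<longleftrightarrow> b \<in> carrier (braid_group n) \<and> braid_perm b \<in> ?A" for b
    by (simp add: aut_braid_group_def)
  show B: "subgroup ?B (braid_group n)"
  proof (rule braid.G.subgroupI)
    show "?B \<subseteq> carrier (braid_group n)" by (auto simp: Bmem)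
    show "?B \<noteq> {}"
      using subgroup.one_closed[OF A] braid.hom_one[of n] braid.G.one_closed[of n]
      unfolding Bmem set_eq_iff by force
  next
    fix b assume "b \<in> ?B"
    then show "inv\<^bsub>braid_group n\<^esub> b \<in> ?B"
      using subgroup.m_inv_closed[OF A] braid.hom_inv[of b n] braid.G.inv_closed[of b n]
      unfolding Bmem by metis
  next
    fix b c assume "b \<in> ?B" "c \<in> ?B"
    then show "b \<otimes>\<^bsub>braid_group n\<^esub> c \<in> ?B"
      using subgroup.m_closed[OF A] braid.hom_mult[of b n c] braid.G.m_closed[of b n c]
      unfolding Bmem by metis
  qed
  have "group (aut_braid_group n E)"
    by (subst Bdef) (rule braid.G.subgroup_imp_group[OF B])
  moreover have "group (graph_aut_group n E)"
    by (subst Adef) (rule group.subgroup_imp_group[OF sym_group_is_group A])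
  moreover have "braid_perm \<in> hom (aut_braid_group n E) (graph_aut_group n E)"
    using braid_perm_hom[of n]
    by (auto simp: hom_def Bmem) (simp add: aut_braid_group_def graph_aut_group_def)
  ultimately show "group_hom (aut_braid_group n E) (graph_aut_group n E) braid_perm"
    by (simp add: group_hom_def group_hom_axioms_def)
  show "braid_perm ` ?B = ?A"
  proof
    show "braid_perm ` ?B \<subseteq> ?A" by (auto simp: Bmem)
    show "?A \<subseteq> braid_perm ` ?B"
    proof
      fix s assume s: "s \<in> ?A"
      then have "s permutes {1..n}"
        by (simp add: graph_aut_group_def sym_group_carrier)
      from braid_perm_surj[OF this] s show "s \<in> braid_perm ` ?B"
        by (auto simp: Bmem)
    qed
  qed
  have "kernel (aut_braid_group n E) (graph_aut_group n E) braid_perm =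
      kernel (braid_group n) (sym_group n) braid_perm"
    using subgroup.one_closed[OF A] by (auto simp: kernel_def Bmem graph_aut_group_def)
  then show "aut_braid_group n E\<lparr>carrier :=
      kernel (aut_braid_group n E) (graph_aut_group n E) braid_perm\<rparr> = pure_braid_group n"
    by (simp add: pure_braid_group_def aut_braid_group_def)
qed

lemma mult_aut_braid_group: "mult (aut_braid_group n E) = mult (braid_group n)"
  by (simp add: aut_braid_group_def)

lemma inv_aut_braid_group:
  assumes "simple_graph n E" "b \<in> carrier (aut_braid_group n E)"
  shows "inv\<^bsub>aut_braid_group n E\<^esub> b = inv\<^bsub>braid_group n\<^esub> b"
proof -
  have "aut_braid_group n E = (braid_group n)\<lparr>carrier := carrier (aut_braid_group n E)\<rparr>"
    by (simp add: aut_braid_group_def)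
  then show ?thesis
    using braid.G.m_inv_consistent[OF aut_braid_group_hom(2)[OF assms(1)] assms(2)] by metis
qed

lemma r_coset_aut_braid_group:
  "N #>\<^bsub>pure_braid_group n\<^esub> x = N #>\<^bsub>aut_braid_group n E\<^esub> x"
  by (simp add: r_coset_def pure_braid_group_def mult_aut_braid_group)

text \<open>
  With \<open>s\<close> the image of \<open>b\<close>, the conjugate is a conjugate of \<open>\<sigma>\<^sub>1\<^sup>2\<close> lying over \<open>{s i, s j}\<close>. So is
  the generator of the graphic kernel with these two indices in increasing order, hence the two
  differ by conjugation with a pure braid.
\<close>

lemma conjugate_generator_in_graphic_kernel:
  assumes E: "simple_graph n E" and b: "b \<in> carrier (aut_braid_group n E)"
    and ij: "1 \<le> i" "i < j" "j \<le> n" "{i, j} \<notin> E"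
    and N: "graphic_kernel n E \<lhd> pure_braid_group n"
  shows "b \<otimes>\<^bsub>braid_group n\<^esub> pure_braid_gen n i j \<otimes>\<^bsub>braid_group n\<^esub> inv\<^bsub>braid_group n\<^esub> b
    \<in> graphic_kernel n E"
proof -
  let ?G = "braid_group n" and ?s = "braid_perm b"
  let ?P = "kernel ?G (sym_group n) braid_perm"
  have bG: "b \<in> carrier ?G" and s: "?s \<in> carrier (graph_aut_group n E)"
    using b by (auto simp: aut_braid_group_def)
  have n: "1 < n" using ij by simp
  obtain g where g: "g \<in> carrier ?G" "braid_perm g 1 = i" "braid_perm g 2 = j"
    "pure_braid_gen n i j = full_twist_conjugate n g"
    using pure_braid_gen_eq_full_twist_conjugate[OF ij(1-3)] by blast
  \<comment> \<open>\<open>s\<close> may reverse the order of \<open>i\<close> and \<open>j\<close>, but generators are indexed by increasing pairs.\<close>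
  define k l where "k = min (?s i) (?s j)" and "l = max (?s i) (?s j)"
  have perm: "?s permutes {1..n}" by (rule braid_perm_permutes[OF bG])
  have "?s i \<in> {1..n}" "?s j \<in> {1..n}"
    using ij permutes_in_image[OF perm] by auto
  moreover have "?s i \<noteq> ?s j"
    using permutes_inj[OF perm] ij(2) by (auto dest: injD)
  ultimately have kl: "1 \<le> k" "k < l" "l \<le> n" "{k, l} = {?s i, ?s j}"
    unfolding k_def l_def by (auto simp: min_def max_def)
  obtain c where c: "c \<in> carrier ?G" "braid_perm c 1 = k" "braid_perm c 2 = l"
    "pure_braid_gen n k l = full_twist_conjugate n c"
    using pure_braid_gen_eq_full_twist_conjugate[OF kl(1-3)] by blast
  have bg: "b \<otimes>\<^bsub>?G\<^esub> g \<in> carrier ?G" using bG g(1) by simp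
  have "braid_perm (b \<otimes>\<^bsub>?G\<^esub> g) ` {1, 2} = braid_perm c ` {1, 2}"
    using g(2,3) c(2,3) kl(4) braid_perm_mult[OF bG g(1)] by simp
  from conjugates_of_full_twist[OF n bg c(1) this] obtain x where x: "x \<in> ?P"
    and eq: "full_twist_conjugate n (b \<otimes>\<^bsub>?G\<^esub> g) =
      x \<otimes>\<^bsub>?G\<^esub> pure_braid_gen n k l \<otimes>\<^bsub>?G\<^esub> inv\<^bsub>?G\<^esub> x"
    by (auto simp: c(4))
  have "{k, l} \<notin> E"
    using ij(4) graph_aut_edge_iff[OF E s] by (simp add: kl(4))
  then have "pure_braid_gen n k l \<in> {pure_braid_gen n i j | i j. 1 \<le> i \<and> i < j \<and> j \<le> n \<and> {i, j} \<notin> E}"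
    using kl(1-3) by blast
  then have "pure_braid_gen n k l \<in> graphic_kernel n E"
    unfolding graphic_kernel_def by (rule subsetD[OF normal_closure_superset])
  moreover have "x \<in> carrier (pure_braid_group n)"
    using x by (simp add: pure_braid_group_def)
  ultimately have "x \<otimes>\<^bsub>pure_braid_group n\<^esub> pure_braid_gen n k l \<otimes>\<^bsub>pure_braid_group n\<^esub>
      inv\<^bsub>pure_braid_group n\<^esub> x \<in> graphic_kernel n E"
    by (intro normal.inv_op_closed2[OF N])
  then have "x \<otimes>\<^bsub>?G\<^esub> pure_braid_gen n k l \<otimes>\<^bsub>?G\<^esub> inv\<^bsub>?G\<^esub> x \<in> graphic_kernel n E"
    using braid.G.m_inv_consistent[OF braid.subgroup_kernel x]
    by (simp add: pure_braid_group_def)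
  then show ?thesis
    using eq conjugate_full_twist_conjugate[OF n bG g(1)] g(4) by simp
qed

lemma pure_braid_gen_pure:
  assumes "1 \<le> i" "i < j" "j \<le> n"
  shows "pure_braid_gen n i j \<in> carrier (pure_braid_group n)"
proof -
  let ?\<sigma> = "braid_sigma n 1"
  have \<sigma>: "?\<sigma> \<in> carrier (braid_group n)" using assms by (simp add: braid_sigma_closed)
  have "?\<sigma> \<otimes>\<^bsub>braid_group n\<^esub> ?\<sigma> \<in> kernel (braid_group n) (sym_group n) braid_perm"
    using \<sigma> assms braid_perm_sigma[of 1 n]
    by (simp add: kernel_def sym_group_mult sym_group_one)
  then have "full_twist_conjugate n g \<in> kernel (braid_group n) (sym_group n) braid_perm"
    if "g \<in> carrier (braid_group n)" for g
    unfolding full_twist_conjugate_def by (rule normal.inv_op_closed2[OF braid.normal_kernel that])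
  then show ?thesis
    using pure_braid_gen_eq_full_twist_conjugate[OF assms] by (auto simp: pure_braid_group_def)
qed

lemma graphic_kernel_normal:
  assumes E: "simple_graph n E"
  shows "graphic_kernel n E \<lhd> pure_braid_group n"
    and "graphic_kernel n E \<lhd> aut_braid_group n E"
proof -
  let ?B = "aut_braid_group n E" and ?A = "graph_aut_group n E"
  let ?S = "{pure_braid_gen n i j | i j. 1 \<le> i \<and> i < j \<and> j \<le> n \<and> {i, j} \<notin> E}"
  note aut = aut_braid_group_hom[OF E]
  interpret p: group_hom ?B ?A braid_perm by (rule aut(1))
  have S: "?S \<subseteq> carrier (pure_braid_group n)"
    using pure_braid_gen_pure by blast
  have "group (pure_braid_group n)"
    using p.G.subgroup_imp_group[OF p.subgroup_kernel] by (simp only: aut(4))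
  then show N: "graphic_kernel n E \<lhd> pure_braid_group n"
    unfolding graphic_kernel_def using S by (rule group.normal_closure_normal)
  have "normal_closure (?B\<lparr>carrier := kernel ?B ?A braid_perm\<rparr>) ?S \<lhd> ?B"
  proof (rule p.G.normal_closure_in_overgroup[OF p.normal_kernel])
    show "?S \<subseteq> kernel ?B ?A braid_perm"
      using S by (simp add: aut(4)[symmetric])
    fix b s assume b: "b \<in> carrier ?B" and "s \<in> ?S"
    then obtain i j where ij: "s = pure_braid_gen n i j" "1 \<le> i" "i < j" "j \<le> n" "{i, j} \<notin> E"
      by blast
    show "b \<otimes>\<^bsub>?B\<^esub> s \<otimes>\<^bsub>?B\<^esub> inv\<^bsub>?B\<^esub> b \<in>
        normal_closure (?B\<lparr>carrier := kernel ?B ?A braid_perm\<rparr>) ?S"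
      using conjugate_generator_in_graphic_kernel[OF E b ij(2-5) N]
      unfolding aut(4) ij(1) graphic_kernel_def mult_aut_braid_group inv_aut_braid_group[OF E b] .
  qed
  then show "graphic_kernel n E \<lhd> ?B"
    by (simp only: aut(4) graphic_kernel_def)
qed

theorem theorem7p4:
  fixes n :: nat and E :: "nat set set"
  assumes "simple_graph n E"
  shows "\<exists>f g. short_exact (graphic_pure_braid_group n E) (graphic_braid_group n E) (graph_aut_group n E) f g
    \<and> (\<forall>x \<in> carrier (pure_braid_group n).
          f (graphic_kernel n E #>\<^bsub>pure_braid_group n\<^esub> x) = graphic_kernel n E #>\<^bsub>aut_braid_group n E\<^esub> x)
    \<and> (\<forall>b \<in> carrier (aut_braid_group n E).
          g (graphic_kernel n E #>\<^bsub>aut_braid_group n E\<^esub> b) = braid_perm b)"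
proof -
  let ?B = "aut_braid_group n E" and ?A = "graph_aut_group n E" and ?N = "graphic_kernel n E"
  note aut = aut_braid_group_hom[OF assms] and N = graphic_kernel_normal[OF assms]
  interpret p: group_hom ?B ?A braid_perm by (rule aut(1))
  have "?N \<subseteq> carrier (pure_braid_group n)"
    using N(1) by (simp add: normal_imp_subgroup subgroup.subset)
  then have "?N \<subseteq> kernel ?B ?A braid_perm"
    by (simp add: aut(4)[symmetric])
  then obtain g where
    "short_exact (?B\<lparr>carrier := kernel ?B ?A braid_perm\<rparr> Mod ?N) (?B Mod ?N) ?A id g"
    and "\<And>b. b \<in> carrier ?B \<Longrightarrow> g (?N #>\<^bsub>?B\<^esub> b) = braid_perm b"
    using p.short_exact_quotients[OF aut(3) N(2)] by blast
  then show ?thesis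
    unfolding graphic_pure_braid_group_def graphic_braid_group_def aut(4)
    by (intro exI[of _ id] exI[of _ g]) (simp add: r_coset_aut_braid_group[where n = n and E = E])
qed

end
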